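(* There exist CSD families (of length one) $A_1$ and $B_1$ in $C([-1,1], \mathcal{M}_2)$ such that $A_1 \prec_{\mathrm{pt}} B_1$ yet $A_1 \nprec_c B_1$.
   Context: $\mathcal{M}_n$ denotes the $n\times n$ complex matrices, $\mathcal{D}_n$ the diagonal matrices, and $C(\mathcal{X},\mathcal{M}_n)$ the continuous functions from $\mathcal{X}$ to $\mathcal{M}_n$. An abelian family in $C(\mathcal{X},\mathcal{M}_n)$ is an $m$-tuple $\vec{A}=(A_1,\dots,A_m)$ of pairwise commuting self-adjoint elements (here $m=1$). $DS_n$ is the set of doubly stochastic matrices: $n\times n$ matrices with non-negative entries all of whose row sums and column sums equal $1$. If $\vec{A},\vec{B}$ are abelian families in $\mathcal{M}_n$, simultaneously diagonalize: $A_j=U^*D_jU$, $B_j=V^*D_j'V$ with $U,V$ unitary and $D_j,D_j'$ diagonal. Let $A$ and $B$ be the $n\times m$ matrices whose $j$-th columns are the diagonals of $D_j$ and $D_j'$ respectively. Then $\vec{A}\prec\vec{B}$ means there is $X\in DS_n$ with $XB=A$ (this does not depend on the chosen diagonalizations). For abelian families in $C(\mathcal{X},\mathcal{M}_n)$, $\vec{A}\prec_{\mathrm{pt}}\vec{B}$ means $\vec{A}(x)\prec\vec{B}(x)$ for every $x\in\mathcal{X}$. An abelian family $(A_1,\dots,A_m)$ in $C(\mathcal{X},\mathcal{M}_n)$ is continuously simultaneously diagonalizable (CSD) if there are a unitary $U\in C(\mathcal{X},\mathcal{M}_n)$ and $D_1,\dots,D_m\in C(\mathcal{X},\mathcal{D}_n)$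 with $A_i=UD_iU^*$ for all $i$. For CSD families $\vec{A},\vec{B}$, write $A_j=U^*D_jU$, $B_j=V^*D_j'V$ with $U,V\in C(\mathcal{X},\mathcal{M}_n)$ unitary and $D_j,D_j'\in C(\mathcal{X},\mathcal{D}_n)$, and let $A,B\in C(\mathcal{X},\mathcal{M}_{n\times m})$ have as $j$-th columns the diagonals of $D_j$ and $D_j'$ respectively. Then $\vec{A}\prec_c\vec{B}$ means there is $X\in C(\mathcal{X},DS_n)$ with $XB=A$ (this does not depend on the chosen diagonalizations). *)

theory Defs
  imports "HOL-Analysis.Analysis"
begin

(* The space is a subset S of a topological type, and an element of C(S, M_n) is a function that
   is continuous on S; its values outside S play no role.  A tuple of length m is a function on a
   finite index type 'm with CARD('m) = m; the type 1 gives tuples of length one. *)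

definition ctranspose :: "complex ^ 'n ^ 'm \<Rightarrow> complex ^ 'm ^ 'n" where
  "ctranspose A = (\<chi> i j. cnj (A $ j $ i))"

definition unitary :: "complex ^ 'n ^ 'n \<Rightarrow> bool" where
  "unitary U \<longleftrightarrow> ctranspose U ** U = mat 1 \<and> U ** ctranspose U = mat 1"

definition diagonal_matrices :: "(complex ^ 'n ^ 'n) set" where
  "diagonal_matrices = {D. \<forall>i j. i \<noteq> j \<longrightarrow> D $ i $ j = 0}"

definition doubly_stochastic :: "(complex ^ 'n ^ 'n) set" where
  "doubly_stochastic = {X. (\<forall>i j. X $ i $ j \<in> \<real>\<^sub>\<ge>\<^sub>0) \<and>
     (\<forall>i. (\<Sum>j\<in>UNIV. X $ i $ j) = 1) \<and> (\<forall>j. (\<Sum>i\<in>UNIV. X $ i $ j) = 1)}"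

definition abelian_family ::
    "'a::topological_space set \<Rightarrow> ('m::finite \<Rightarrow> 'a \<Rightarrow> complex ^ 'n ^ 'n) \<Rightarrow> bool" where
  "abelian_family S A \<longleftrightarrow>
     (\<forall>j. continuous_on S (A j)) \<and>
     (\<forall>j. \<forall>x\<in>S. ctranspose (A j x) = A j x) \<and>
     (\<forall>j k. \<forall>x\<in>S. A j x ** A k x = A k x ** A j x)"

definition CSD ::
    "'a::topological_space set \<Rightarrow> ('m::finite \<Rightarrow> 'a \<Rightarrow> complex ^ 'n ^ 'n) \<Rightarrow> bool" where
  "CSD S A \<longleftrightarrow> abelian_family S A \<and>
     (\<exists>U D. continuous_on S U \<and> (\<forall>x\<in>S. unitary (U x)) \<and>
       (\<forall>j. continuous_on S (D j) \<and> (\<forall>x\<in>S. D j x \<in> diagonal_matrices)) \<and>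
       (\<forall>j. \<forall>x\<in>S. A j x = U x ** D j x ** ctranspose (U x)))"

definition diagonalizes ::
    "complex ^ 'n ^ 'n \<Rightarrow> ('m::finite \<Rightarrow> complex ^ 'n ^ 'n) \<Rightarrow> ('m \<Rightarrow> complex ^ 'n ^ 'n) \<Rightarrow> bool" where
  "diagonalizes U D A \<longleftrightarrow> unitary U \<and>
     (\<forall>j. D j \<in> diagonal_matrices \<and> A j = ctranspose U ** D j ** U)"

(* the n x m matrix whose j-th column is the diagonal of D j *)
definition diag_columns :: "('m::finite \<Rightarrow> complex ^ 'n ^ 'n) \<Rightarrow> complex ^ 'm ^ 'n" where
  "diag_columns D = (\<chi> i j. D j $ i $ i)"

(* Both majorization relations are stated for some choice of diagonalizations; the lemmas
   majorized_iff and majorized_c_iff show that any other choice gives the same relation. *)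

definition majorized ::
    "('m::finite \<Rightarrow> complex ^ 'n ^ 'n) \<Rightarrow> ('m \<Rightarrow> complex ^ 'n ^ 'n) \<Rightarrow> bool" where
  "majorized A B \<longleftrightarrow> (\<exists>U D V D'. diagonalizes U D A \<and> diagonalizes V D' B \<and>
     (\<exists>X\<in>doubly_stochastic. X ** diag_columns D' = diag_columns D))"

definition majorized_pt ::
    "'a::topological_space set \<Rightarrow> ('m::finite \<Rightarrow> 'a \<Rightarrow> complex ^ 'n ^ 'n) \<Rightarrow>
     ('m \<Rightarrow> 'a \<Rightarrow> complex ^ 'n ^ 'n) \<Rightarrow> bool" where
  "majorized_pt S A B \<longleftrightarrow> (\<forall>x\<in>S. majorized (\<lambda>j. A j x) (\<lambda>j. B j x))"

definition diagonalizes_on ::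
    "'a::topological_space set \<Rightarrow> ('a \<Rightarrow> complex ^ 'n ^ 'n) \<Rightarrow>
     ('m::finite \<Rightarrow> 'a \<Rightarrow> complex ^ 'n ^ 'n) \<Rightarrow> ('m \<Rightarrow> 'a \<Rightarrow> complex ^ 'n ^ 'n) \<Rightarrow> bool" where
  "diagonalizes_on S U D A \<longleftrightarrow> continuous_on S U \<and> (\<forall>j. continuous_on S (D j)) \<and>
     (\<forall>x\<in>S. diagonalizes (U x) (\<lambda>j. D j x) (\<lambda>j. A j x))"

definition majorized_c ::
    "'a::topological_space set \<Rightarrow> ('m::finite \<Rightarrow> 'a \<Rightarrow> complex ^ 'n ^ 'n) \<Rightarrow>
     ('m \<Rightarrow> 'a \<Rightarrow> complex ^ 'n ^ 'n) \<Rightarrow> bool" where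
  "majorized_c S A B \<longleftrightarrow>
     (\<exists>U D V D'. diagonalizes_on S U D A \<and> diagonalizes_on S V D' B \<and>
       (\<exists>X. continuous_on S X \<and> (\<forall>x\<in>S. X x \<in> doubly_stochastic) \<and>
         (\<forall>x\<in>S. X x ** diag_columns (\<lambda>j. D' j x) = diag_columns (\<lambda>j. D j x))))"

lemma doubly_stochastic_mult:
  assumes "X \<in> doubly_stochastic" "Y \<in> doubly_stochastic"
  shows "X ** Y \<in> doubly_stochastic"
proof -
  have nn: "(X ** Y) $ i $ j \<in> \<real>\<^sub>\<ge>\<^sub>0" for i j
    using assms unfolding doubly_stochastic_def matrix_matrix_mult_def
    by (auto simp: complex_nonneg_Reals_iff intro!: sum_nonneg)
  have "(\<Sum>j\<in>UNIV. (X ** Y) $ i $ j) = (\<Sum>k\<in>UNIV. X $ i $ k * (\<Sum>j\<in>UNIV. Y $ k $ j))" for i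
    unfolding matrix_matrix_mult_def by (simp add: sum_distrib_left) (rule sum.swap)
  then have r: "(\<Sum>j\<in>UNIV. (X ** Y) $ i $ j) = 1" for i
    using assms by (simp add: doubly_stochastic_def)
  have "(\<Sum>i\<in>UNIV. (X ** Y) $ i $ j) = (\<Sum>k\<in>UNIV. (\<Sum>i\<in>UNIV. X $ i $ k) * Y $ k $ j)" for j
    unfolding matrix_matrix_mult_def by (simp add: sum_distrib_right) (rule sum.swap)
  then have c: "(\<Sum>i\<in>UNIV. (X ** Y) $ i $ j) = 1" for j
    using assms by (simp add: doubly_stochastic_def)
  show ?thesis
    using nn r c by (simp add: doubly_stochastic_def)
qed

definition unistochastic :: "complex ^ 'n ^ 'n \<Rightarrow> complex ^ 'n ^ 'n" where
  "unistochastic W = (\<chi> i j. W $ i $ j * cnj (W $ i $ j))"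

lemma unitary_mult_ctranspose:
  assumes "unitary U" "unitary V"
  shows "unitary (V ** ctranspose U)"
proof -
  have ct: "ctranspose (V ** ctranspose U) = U ** ctranspose V"
    by (simp add: ctranspose_def matrix_matrix_mult_def vec_eq_iff mult.commute)
  show ?thesis
    unfolding unitary_def ct using assms unfolding unitary_def
    by (metis matrix_mul_assoc matrix_mul_rid)
qed

lemma unistochastic_doubly_stochastic:
  assumes "unitary W"
  shows "unistochastic W \<in> doubly_stochastic"
proof -
  have "(ctranspose W ** W) $ j $ j = 1" "(W ** ctranspose W) $ j $ j = 1" for j
    using assms by (simp_all add: unitary_def mat_def)
  then show ?thesis
    unfolding doubly_stochastic_def unistochastic_def
    by (simp add: ctranspose_def matrix_matrix_mult_def complex_nonneg_Reals_iff mult.commute)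
qed

lemma diag_columns_change:
  assumes "diagonalizes U D A" "diagonalizes V D' A"
  shows "unistochastic (V ** ctranspose U) ** diag_columns D = diag_columns D'"
proof -
  define W where "W = V ** ctranspose U"
  have ct: "ctranspose W = U ** ctranspose V"
    by (simp add: W_def ctranspose_def matrix_matrix_mult_def vec_eq_iff mult.commute)
  have eq: "W ** D j ** ctranspose W = D' j" for j
  proof -
    have "W ** D j ** ctranspose W = V ** (ctranspose U ** D j ** U) ** ctranspose V"
      unfolding ct by (simp add: W_def matrix_mul_assoc)
    also have "\<dots> = V ** (ctranspose V ** D' j ** V) ** ctranspose V"
      using assms unfolding diagonalizes_def by metis
    also have "\<dots> = (V ** ctranspose V) ** D' j ** (V ** ctranspose V)"
      by (simp add: matrix_mul_assoc)
    also have "\<dots> = D' j"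
      using assms by (simp add: diagonalizes_def unitary_def)
    finally show ?thesis .
  qed
  have "(unistochastic W ** diag_columns D) $ i $ j = D' j $ i $ i" for i j
  proof -
    have dg: "D j $ k $ l = (if k = l then D j $ l $ l else 0)" for k l
      using assms(1) by (auto simp: diagonalizes_def diagonal_matrices_def)
    have "(W ** D j) $ i $ l = W $ i $ l * D j $ l $ l" for l
      unfolding matrix_matrix_mult_def
      by (simp, subst dg) (simp add: if_distrib cong: if_cong)
    then have "(W ** D j ** ctranspose W) $ i $ i
        = (\<Sum>k\<in>UNIV. W $ i $ k * D j $ k $ k * cnj (W $ i $ k))"
      by (subst matrix_matrix_mult_def) (simp add: ctranspose_def)
    then show ?thesis
      unfolding eq
      by (simp add: unistochastic_def diag_columns_def matrix_matrix_mult_def mult_ac)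
  qed
  then show ?thesis
    by (simp add: W_def[symmetric] vec_eq_iff diag_columns_def)
qed

lemma majorized_iff:
  assumes "diagonalizes U D A" "diagonalizes V D' B"
  shows "majorized A B \<longleftrightarrow> (\<exists>X\<in>doubly_stochastic. X ** diag_columns D' = diag_columns D)"
proof
  assume "majorized A B"
  then obtain U1 D1 V1 D1' X where *: "diagonalizes U1 D1 A" "diagonalizes V1 D1' B"
    "X \<in> doubly_stochastic" "X ** diag_columns D1' = diag_columns D1"
    unfolding majorized_def by blast
  let ?P = "unistochastic (U ** ctranspose U1)" and ?Q = "unistochastic (V1 ** ctranspose V)"
  have "?P ** X ** ?Q ** diag_columns D' = ?P ** (X ** (?Q ** diag_columns D'))"
    by (simp add: matrix_mul_assoc)
  also have "\<dots> = diag_columns D"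
    using * assms by (simp add: diag_columns_change)
  finally have "?P ** X ** ?Q ** diag_columns D' = diag_columns D" .
  moreover have "?P ** X ** ?Q \<in> doubly_stochastic"
    using * assms by (intro doubly_stochastic_mult unistochastic_doubly_stochastic
        unitary_mult_ctranspose) (auto simp: diagonalizes_def)
  ultimately show "\<exists>X\<in>doubly_stochastic. X ** diag_columns D' = diag_columns D"
    by blast
qed (use assms majorized_def in blast)

lemma continuous_on_unistochastic:
  fixes U V :: "'a::topological_space \<Rightarrow> complex ^ 'n ^ 'n"
  assumes "continuous_on S U" "continuous_on S V"
  shows "continuous_on S (\<lambda>x. unistochastic (V x ** ctranspose (U x)))"
  unfolding unistochastic_def ctranspose_def matrix_matrix_mult_def
  by (simp, intro continuous_intros continuous_on_vec_lambda assms)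

lemma continuous_on_matrix_mult:
  fixes X Y :: "'a::topological_space \<Rightarrow> complex ^ 'n ^ 'n"
  assumes "continuous_on S X" "continuous_on S Y"
  shows "continuous_on S (\<lambda>x. X x ** Y x)"
  unfolding matrix_matrix_mult_def
  by (intro continuous_intros continuous_on_vec_lambda assms)

lemma majorized_c_iff:
  assumes "diagonalizes_on S U D A" "diagonalizes_on S V D' B"
  shows "majorized_c S A B \<longleftrightarrow>
    (\<exists>X. continuous_on S X \<and> (\<forall>x\<in>S. X x \<in> doubly_stochastic) \<and>
      (\<forall>x\<in>S. X x ** diag_columns (\<lambda>j. D' j x) = diag_columns (\<lambda>j. D j x)))"
    (is "_ \<longleftrightarrow> ?R")
proof
  assume "majorized_c S A B"
  then obtain U1 D1 V1 D1' X where *: "diagonalizes_on S U1 D1 A" "diagonalizes_on S V1 D1' B"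
    "continuous_on S X" "\<forall>x\<in>S. X x \<in> doubly_stochastic"
    "\<forall>x\<in>S. X x ** diag_columns (\<lambda>j. D1' j x) = diag_columns (\<lambda>j. D1 j x)"
    unfolding majorized_c_def by blast
  let ?P = "\<lambda>x. unistochastic (U x ** ctranspose (U1 x))"
  let ?Q = "\<lambda>x. unistochastic (V1 x ** ctranspose (V x))"
  let ?Y = "\<lambda>x. ?P x ** X x ** ?Q x"
  have "continuous_on S ?Y"
    using * assms unfolding diagonalizes_on_def
    by (intro continuous_on_matrix_mult continuous_on_unistochastic) auto
  moreover have "?Y x \<in> doubly_stochastic" if "x \<in> S" for x
    using * assms that by (intro doubly_stochastic_mult unistochastic_doubly_stochastic
        unitary_mult_ctranspose) (auto simp: diagonalizes_on_def diagonalizes_def)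
  moreover have "?Y x ** diag_columns (\<lambda>j. D' j x) = diag_columns (\<lambda>j. D j x)" if "x \<in> S" for x
  proof -
    have d: "diagonalizes (U x) (\<lambda>j. D j x) (\<lambda>j. A j x)"
      "diagonalizes (U1 x) (\<lambda>j. D1 j x) (\<lambda>j. A j x)"
      "diagonalizes (V x) (\<lambda>j. D' j x) (\<lambda>j. B j x)"
      "diagonalizes (V1 x) (\<lambda>j. D1' j x) (\<lambda>j. B j x)"
      using * assms that by (auto simp: diagonalizes_on_def)
    have "?Y x ** diag_columns (\<lambda>j. D' j x)
        = ?P x ** (X x ** (?Q x ** diag_columns (\<lambda>j. D' j x)))"
      by (simp add: matrix_mul_assoc)
    also have "\<dots> = diag_columns (\<lambda>j. D j x)"
      using * that diag_columns_change[OF d(3,4)] diag_columns_change[OF d(2,1)] by simp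
    finally show ?thesis .
  qed
  ultimately show ?R
    by blast
next
  assume ?R
  then show "majorized_c S A B"
    unfolding majorized_c_def using assms by blast
qed

end

theory Submission
  imports Defs
begin

text \<open>Take A(x) = diag(|x|, -|x|) and B(x) = diag(x, -x). At each point the
  identity or the transposition matrix is a witness for majorization. Any doubly stochastic witness
  has (1,1) entry 1 for x > 0 and 0 for x < 0, which no continuous function on [-1,1]
  can have.\<close>

text \<open>Both families have this shape, with \<open>s\<close> replaced by a continuous real
  function of the point. The matrix is already diagonal, so \<open>mat 1\<close> diagonalizes either
  family.\<close>

definition diag_pm :: "real \<Rightarrow> complex ^ 2 ^ 2" where
  "diag_pm s = (\<chi> i j. if i = j then (if i = 1 then of_real s else - of_real s) else 0)"

lemma ctranspose_mat_1: "ctranspose (mat 1) = mat 1"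
  by (simp add: ctranspose_def mat_def vec_eq_iff)

lemma unitary_mat_1: "unitary (mat 1)"
  by (simp add: unitary_def ctranspose_mat_1)

lemma diag_pm_diagonal: "diag_pm s \<in> diagonal_matrices"
  by (simp add: diagonal_matrices_def diag_pm_def)

lemma ctranspose_diag_pm: "ctranspose (diag_pm s) = diag_pm s"
  by (simp add: ctranspose_def diag_pm_def vec_eq_iff)

lemma continuous_on_diag_pm:
  assumes "continuous_on S f"
  shows "continuous_on S (\<lambda>x. diag_pm (f x))"
proof -
  have "continuous_on S (\<lambda>x. if i = j then if i = 1 then complex_of_real (f x)
      else - complex_of_real (f x) else 0)" for i j :: 2
    using assms by (cases "i = j"; cases "i = 1") (auto intro!: continuous_intros)
  then show ?thesis
    unfolding diag_pm_def by (intro continuous_on_vec_lambda)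
qed

lemma CSD_diag_pm:
  assumes "continuous_on S f"
  shows "CSD S (\<lambda>_::1. \<lambda>x. diag_pm (f x))"
  unfolding CSD_def abelian_family_def
  using assms
  by (auto simp: ctranspose_diag_pm diag_pm_diagonal ctranspose_mat_1 unitary_mat_1
      intro!: continuous_on_diag_pm exI[of _ "\<lambda>_. mat 1"] exI[of _ "\<lambda>_ x. diag_pm (f x)"])

lemma diagonalizes_diag_pm: "diagonalizes (mat 1) (\<lambda>_::1. diag_pm s) (\<lambda>_. diag_pm s)"
  by (simp add: diagonalizes_def unitary_mat_1 diag_pm_diagonal ctranspose_mat_1)

lemma diagonalizes_on_diag_pm:
  assumes "continuous_on S f"
  shows "diagonalizes_on S (\<lambda>_. mat 1) (\<lambda>_::1. \<lambda>x. diag_pm (f x)) (\<lambda>_ x. diag_pm (f x))"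
  using assms by (simp add: diagonalizes_on_def continuous_on_diag_pm diagonalizes_diag_pm)

lemma majorized_diag_pm_abs: "majorized (\<lambda>_::1. diag_pm \<bar>s\<bar>) (\<lambda>_. diag_pm s)"
proof -
  \<comment> \<open>This is the identity for \<open>0 \<le> s\<close> and the swap of the two
    coordinates for \<open>s < 0\<close>; the swap turns the column \<open>(s, -s)\<close> into
    \<open>(-s, s)\<close>.\<close>
  let ?X = "(\<chi> i j. if (i = j) = (0 \<le> s) then 1 else 0) :: complex ^ 2 ^ 2"
  have "?X \<in> doubly_stochastic"
    by (simp add: doubly_stochastic_def UNIV_2 forall_2)
  moreover have "?X ** diag_columns (\<lambda>_::1. diag_pm s) = diag_columns (\<lambda>_. diag_pm \<bar>s\<bar>)"
    by (simp add: vec_eq_iff matrix_matrix_mult_def diag_columns_def diag_pm_def sum_2 forall_2)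
  ultimately show ?thesis
    using majorized_iff[OF diagonalizes_diag_pm diagonalizes_diag_pm] by blast
qed

text \<open>The first row of \<open>X\<close> is \<open>(p, 1 - p)\<close>, and its product with the
  column \<open>(s, -s)\<close> is \<open>p * s - (1 - p) * s\<close>. For nonzero \<open>s\<close>
  this determines \<open>p\<close>.\<close>

lemma doubly_stochastic_diag_pm_entry:
  assumes "X \<in> doubly_stochastic"
    and "X ** diag_columns (\<lambda>_::1. diag_pm s) = diag_columns (\<lambda>_. diag_pm t)"
  shows "(2 * Re (X $ 1 $ 1) - 1) * s = t"
proof -
  have "X $ 1 $ 1 + X $ 1 $ 2 = 1"
    using assms(1) by (simp add: doubly_stochastic_def sum_2)
  then have x12: "Re (X $ 1 $ 2) = 1 - Re (X $ 1 $ 1)"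
    by (metis add_diff_cancel_left' minus_complex.simps(1) one_complex.simps(1))
  have "X $ 1 $ 1 * of_real s - X $ 1 $ 2 * of_real s = of_real t"
    using arg_cong[OF assms(2), of "\<lambda>M. M $ 1 $ 1"]
    by (simp add: matrix_matrix_mult_def diag_columns_def diag_pm_def sum_2)
  then have "Re (X $ 1 $ 1 * of_real s - X $ 1 $ 2 * of_real s) = t"
    by simp
  then show ?thesis
    by (simp add: x12 algebra_simps)
qed

lemma not_majorized_c_diag_pm_abs:
  "\<not> majorized_c {-1..1} (\<lambda>_::1. \<lambda>x::real. diag_pm \<bar>x\<bar>) (\<lambda>_ x. diag_pm x)"
proof
  assume "majorized_c {-1..1} (\<lambda>_::1. \<lambda>x::real. diag_pm \<bar>x\<bar>) (\<lambda>_ x. diag_pm x)"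
  \<comment> \<open>By \<open>majorized_c_iff\<close>, refuting a continuous \<open>X\<close> for
    these constant diagonalizations refutes it for all of them.\<close>
  moreover have d: "diagonalizes_on {-1..1} (\<lambda>_. mat 1) (\<lambda>_::1. \<lambda>x::real. diag_pm \<bar>x\<bar>)
      (\<lambda>_ x. diag_pm \<bar>x\<bar>)"
    "diagonalizes_on {-1..1} (\<lambda>_. mat 1) (\<lambda>_::1. \<lambda>x::real. diag_pm x) (\<lambda>_ x. diag_pm x)"
    by (intro diagonalizes_on_diag_pm continuous_intros)+
  ultimately obtain X where X: "continuous_on {-1..1::real} X"
    "\<And>x. x \<in> {-1..1} \<Longrightarrow> X x \<in> doubly_stochastic"
    "\<And>x. x \<in> {-1..1} \<Longrightarrow>
      X x ** diag_columns (\<lambda>_::1. diag_pm x) = diag_columns (\<lambda>_. diag_pm \<bar>x\<bar>)"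
    unfolding majorized_c_iff[OF d] by blast
  \<comment> \<open>Matrix entries are complex by type; the real part gives a function to which the
    IVT applies.\<close>
  define f where "f x = Re (X x $ 1 $ 1)" for x
  have cont: "continuous_on {-1..1} f"
    unfolding f_def by (intro continuous_intros X)
  have f: "(2 * f x - 1) * x = \<bar>x\<bar>" if "x \<in> {-1..1}" for x
    unfolding f_def using X(2,3)[OF that] by (rule doubly_stochastic_diag_pm_entry)
  have ends: "f (-1) = 0" "f 1 = 1"
    using f[of "-1"] f[of 1] by auto
  \<comment> \<open>Values strictly between 0 and 1 can only be taken at 0, so by the IVT 0 would be sent to every one of them.\<close>
  have "f 0 = v" if v: "0 < v" "v < 1" for v
  proof -
    obtain c where c: "c \<in> {-1..1}" "f c = v"
      using IVT'[of f "-1" v 1] v ends cont by auto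
    then have "(2 * v - 1) * c = \<bar>c\<bar>"
      using f by blast
    \<comment> \<open>A positive \<open>c\<close> would force \<open>v = 1\<close>, a negative one
      \<open>v = 0\<close>.\<close>
    then have "c = 0"
      using v by (cases "c \<ge> 0") (auto simp: algebra_simps)
    with c show ?thesis
      by simp
  qed
  from this[of "1/4"] this[of "3/4"] show False
    by simp
qed

theorem proposition3p1:
  shows "\<exists>A B :: 1 \<Rightarrow> real \<Rightarrow> complex ^ 2 ^ 2.
    CSD {-1..1} A \<and> CSD {-1..1} B \<and>
    majorized_pt {-1..1} A B \<and> \<not> majorized_c {-1..1} A B"
proof (intro exI conjI)
  show "CSD {-1..1} (\<lambda>_::1. \<lambda>x::real. diag_pm \<bar>x\<bar>)" "CSD {-1..1} (\<lambda>_::1. \<lambda>x::real. diag_pm x)"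
    by (intro CSD_diag_pm continuous_intros)+
  show "majorized_pt {-1..1} (\<lambda>_::1. \<lambda>x::real. diag_pm \<bar>x\<bar>) (\<lambda>_ x. diag_pm x)"
    by (simp add: majorized_pt_def majorized_diag_pm_abs)
qed (rule not_majorized_c_diag_pm_abs)

end
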